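(* Consider the optimal control problem $(\mathrm{pH\,OCP}_T)$ of minimizing the supplied energy $\int_0^T y^{\mathsf T}u\,\mathrm dt$ for the port-Hamiltonian descriptor system (pH) with fixed initial and final values $x_0,x_T$, as defined in the context. Let $f:\mathbb R^n\to\mathbb R^n$, $f(x)=R(x)^{1/2}\eta(x)$, and $\mathcal M=\{x\in\mathbb R^n\mid f(x)=0\}$. Assume: (A1) $f$ is of class $C^2$. (A2) $\mathcal M$ is nonempty and there exist an open neighborhood $G\subseteq\mathbb R^n$ of $\mathcal M$ and a constant $s$ with $0<s<n$ such that $\dim(\ker(Df_x))=s$ for all $x\in G$. (A3) There is a constant $\tilde c>0$ such that for each $x\in G$ the smallest nonzero singular value of $Df_x$ is bounded from below by $\tilde c$. (A4) Let $V\subseteq\mathbb R^n$ be an open set with $\mathcal M\subseteq V\subseteq\mathcal E(\mathcal M)$ for which there is a constant $c>0$ with $c\,\mathrm{dist}(x,\mathcal M)\le\|f(x)\|$ for all $x\in V$ (such a $V$ exists under (A1)--(A3); one such $V$ is fixed). Any optimal trajectory $x^*$ of $(\mathrm{pH\,OCP}_T)$ remains in $V$ for all times. Then $(\mathrm{pH\,OCP}_T)$ is dissipative with respect to the manifold $\mathcal M$ with storage function $\mathcal H$. That is, $\mathcal H$ is bounded on compact sets and there exists $\alpha\in\mathcal K$ such that for all $T>0$, all optimal controls $u^*$ with associated trajectories $x^*$ and outputs $y^*$ satisfy $$\mathcal H(x_T)-\mathcal H(x_0)\le\int_0^T {y^*}^{\mathsf T}u^*-\alpha(\mathrm{dist}(x^*,\mathcal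 M))\,\mathrm dt .$$
   Context: System (pH): the state space is $\mathcal X=\mathbb R^n$, $\mathcal U_{\mathrm{ad}}$ is a set of admissible controls, and $$E(x)\dot x=(J(x)-R(x))\eta(x)+B(x)u,\qquad y=B(x)^{\mathsf T}\eta(x),$$ where $x,u,y$ are the state, input and output, $E,J,R\in C(\mathcal X,\mathbb R^{n,n})$, $\eta\in C(\mathcal X,\mathbb R^n)$, $B\in C(\mathcal X,\mathbb R^{n,m})$, and $J(x)=-J(x)^{\mathsf T}$, $R(x)=R(x)^{\mathsf T}\succeq0$ (positive semidefinite) for all $x\in\mathcal X$. The system is associated with a Hamiltonian $\mathcal H\in C^1(\mathcal X,\mathbb R)$ whose gradient satisfies $\nabla\mathcal H(x)=E(x)^{\mathsf T}\eta(x)$ for all $x\in\mathcal X$, and which is nonnegative along any solution of (pH). Solutions are understood in a sense for which $t\mapsto\mathcal H(x(t))$ is absolutely continuous and the power balance $\frac{\mathrm d}{\mathrm dt}\mathcal H(x)=-\eta(x)^{\mathsf T}R(x)\eta(x)+y^{\mathsf T}u$ holds along every solution. Optimal control problem $(\mathrm{pH\,OCP}_T)$: for $T>0$, $$\min_{u\in\mathcal U_{\mathrm{ad}}}\ \int_0^T y^{\mathsf T}u\,\mathrm dt\quad\text{subject to (pH) and } x(0)=x_0,\ x(T)=x_T,$$ with $x_0,x_T\in K$, where $K\subseteq\mathbb R^n$ is compact. It is assumed throughout that an optimal control $u^*$ and a corresponding (optimal) trajectory $x^*$ exist; $y^*$ is the corresponding output. Notation: $\|\cdot\|$ is the Euclidean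 norm; $A^{1/2}$ is the nonnegative square root of a positive semidefinite matrix $A$; $Df_x$ is the derivative of $f$ at $x$; $\mathrm{dist}(x,\mathcal M)=\inf_{p\in\mathcal M}\|x-p\|$. $\mathrm{unpp}(\mathcal M)$ is the set of $x\in\mathbb R^n$ for which there is a unique $\xi\in\mathcal M$ with $\|x-\xi\|=\mathrm{dist}(x,\mathcal M)$, and $\mathcal E(\mathcal M)$ is the interior of $\mathrm{unpp}(\mathcal M)$. $\mathcal K$ is the set of continuous, strictly increasing functions $\alpha:[0,\infty)\to[0,\infty)$ with $\alpha(0)=0$. Dissipativity: an optimal control problem with running cost $\ell(x,u)$ on $[0,T]$ and boundary values $x_0,x_T$ is dissipative with respect to a manifold $\mathcal M\subseteq\mathbb R^n$ if there exist a nonnegative function $\mathcal S$ on $\mathbb R^n$ bounded on compact sets (the storage function) and $\alpha\in\mathcal K$ such that all optimal controls $u^*$ and associated trajectories $x^*$ satisfy $\mathcal S(x_T)-\mathcal S(x_0)\le\int_0^T\ell(x^*,u^* )-\alpha(\mathrm{dist}(x^*,\mathcal M))\,\mathrm dt$ for all $T>0$. Here $\ell$ is the supplied power $y^{\mathsf T}u$, and for the storage function $\mathcal H$ nonnegativity is understood along solutions of (pH), as assumed above. (Under (A1) and (A2), $\mathcal M$ is an $s$-dimensional $C^2$ submanifold of $\mathbb R^n$.) *)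

theory Defs
  imports "HOL-Analysis.Analysis"
begin

definition C1_map :: "('a::real_normed_vector \<Rightarrow> 'b::real_normed_vector) \<Rightarrow> bool" where
  "C1_map f \<longleftrightarrow> (\<exists>f' :: 'a \<Rightarrow> 'a \<Rightarrow>\<^sub>L 'b.
     (\<forall>x. (f has_derivative blinfun_apply (f' x)) (at x)) \<and> continuous_on UNIV f')"

definition C2_map :: "('a::real_normed_vector \<Rightarrow> 'b::real_normed_vector) \<Rightarrow> bool" where
  "C2_map f \<longleftrightarrow> (\<exists>f' :: 'a \<Rightarrow> 'a \<Rightarrow>\<^sub>L 'b.
     (\<forall>x. (f has_derivative blinfun_apply (f' x)) (at x)) \<and> C1_map f')"

definition psd :: "real^'n^'n \<Rightarrow> bool" where
  "psd A \<longleftrightarrow> transpose A = A \<and> (\<forall>v. 0 \<le> v \<bullet> (A *v v))"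

(* Meaningful for psd A only, where the square root exists and is unique. *)
definition psd_sqrt :: "real^'n^'n \<Rightarrow> real^'n^'n" where
  "psd_sqrt A = (THE S. psd S \<and> S ** S = A)"

definition singular_values :: "real^'n^'m \<Rightarrow> real set" where
  "singular_values A =
     {sqrt \<mu> | \<mu>. \<exists>v. v \<noteq> 0 \<and> (transpose A ** A) *v v = \<mu> *\<^sub>R v}"

(* The set is finite, and it is nonempty whenever A is not the zero matrix. *)
definition smallest_nonzero_singular_value :: "real^'n^'m \<Rightarrow> real" where
  "smallest_nonzero_singular_value A = Min (singular_values A - {0})"

(* Points with a unique nearest point in M. *)
definition unpp :: "'a::metric_space set \<Rightarrow> 'a set" where
  "unpp M = {x. \<exists>!\<xi>. \<xi> \<in> M \<and> dist x \<xi> = infdist x M}"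

definition class_K :: "(real \<Rightarrow> real) set" where
  "class_K = {\<alpha>. continuous_on {0..} \<alpha> \<and> strict_mono_on {0..} \<alpha> \<and> \<alpha> 0 = 0}"

(* Absolute continuity on [a,b]; D is a finite family of non-overlapping intervals [s,t]. *)
definition abs_continuous :: "real \<Rightarrow> real \<Rightarrow> (real \<Rightarrow> real) \<Rightarrow> bool" where
  "abs_continuous a b h \<longleftrightarrow>
     (\<forall>\<epsilon>>0. \<exists>\<delta>>0. \<forall>D. finite D \<and> (\<forall>(s,t)\<in>D. a \<le> s \<and> s \<le> t \<and> t \<le> b) \<and>
        pairwise (\<lambda>(s,t) (s',t'). {s<..<t} \<inter> {s'<..<t'} = {}) D \<and>
        (\<Sum>(s,t)\<in>D. t - s) < \<delta> \<longrightarrow> (\<Sum>(s,t)\<in>D. \<bar>h t - h s\<bar>) < \<epsilon>)"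


definition ph_output ::
  "(real^'n \<Rightarrow> real^'m^'n) \<Rightarrow> (real^'n \<Rightarrow> real^'n) \<Rightarrow> real^'n \<Rightarrow> real^'m" where
  "ph_output B \<eta> x = transpose (B x) *v \<eta> x"

definition supplied_power ::
  "(real^'n \<Rightarrow> real^'m^'n) \<Rightarrow> (real^'n \<Rightarrow> real^'n) \<Rightarrow> real^'n \<Rightarrow> real^'m \<Rightarrow> real" where
  "supplied_power B \<eta> x u = ph_output B \<eta> x \<bullet> u"

(* The least that is required of a solution on [0,T]: the descriptor equation holds almost
   everywhere (x itself need not be continuous, as algebraic components may jump), the
   Hamiltonian is absolutely continuous along x, and the power balance holds. *)
definition ph_solution ::
  "(real^'n \<Rightarrow> real^'n^'n) \<Rightarrow> (real^'n \<Rightarrow> real^'n^'n) \<Rightarrow> (real^'n \<Rightarrow> real^'n^'n) \<Rightarrow>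
   (real^'n \<Rightarrow> real^'n) \<Rightarrow> (real^'n \<Rightarrow> real^'m^'n) \<Rightarrow> (real^'n \<Rightarrow> real) \<Rightarrow>
   real \<Rightarrow> (real \<Rightarrow> real^'m) \<Rightarrow> (real \<Rightarrow> real^'n) \<Rightarrow> bool" where
  "ph_solution E J R \<eta> B H T u x \<longleftrightarrow>
     (AE t\<in>{0..T} in lebesgue. \<exists>x'.
        (x has_vector_derivative x') (at t within {0..T}) \<and>
        E (x t) *v x' = (J (x t) - R (x t)) *v \<eta> (x t) + B (x t) *v u t) \<and>
     abs_continuous 0 T (\<lambda>t. H (x t)) \<and>
     (AE t\<in>{0..T} in lebesgue.
        ((\<lambda>t. H (x t)) has_real_derivative
           - (\<eta> (x t) \<bullet> (R (x t) *v \<eta> (x t))) + ph_output B \<eta> (x t) \<bullet> u t)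
          (at t within {0..T}))"

(* Sol T u x: x is a solution on [0,T] for the control u, in the solution concept under
   consideration. The concept is left open (classical, absolutely continuous, ...) except that
   its solutions have to satisfy ph_solution. *)
locale port_hamiltonian =
  fixes E :: "real^'n \<Rightarrow> real^'n^'n"
    and J :: "real^'n \<Rightarrow> real^'n^'n"
    and R :: "real^'n \<Rightarrow> real^'n^'n"
    and \<eta> :: "real^'n \<Rightarrow> real^'n"
    and B :: "real^'n \<Rightarrow> real^'m^'n"
    and H :: "real^'n \<Rightarrow> real"
    and Uad :: "(real \<Rightarrow> real^'m) set"
    and Sol :: "real \<Rightarrow> (real \<Rightarrow> real^'m) \<Rightarrow> (real \<Rightarrow> real^'n) \<Rightarrow> bool"
  assumes cont_E: "continuous_on UNIV E"
    and cont_J: "continuous_on UNIV J"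
    and cont_R: "continuous_on UNIV R"
    and cont_eta: "continuous_on UNIV \<eta>"
    and cont_B: "continuous_on UNIV B"
    and skew_J: "J x = - transpose (J x)"
    and psd_R: "psd (R x)"
    and C1_H: "C1_map H"
    and grad_H: "GDERIV H x :> transpose (E x) *v \<eta> x"
    and Sol: "\<lbrakk>T > 0; u \<in> Uad; Sol T u \<xi>\<rbrakk> \<Longrightarrow> ph_solution E J R \<eta> B H T u \<xi>"
    and H_nonneg: "\<lbrakk>T > 0; u \<in> Uad; Sol T u \<xi>; t \<in> {0..T}\<rbrakk> \<Longrightarrow> 0 \<le> H (\<xi> t)"


(* Optimal control on [0,T] with running cost l and boundary values x0, xT. Integrability of the
   running cost is part of feasibility, so that the cost below is a genuine integral. *)
definition ocp_feasible ::
  "(real \<Rightarrow> 'u) set \<Rightarrow> (real \<Rightarrow> (real \<Rightarrow> 'u) \<Rightarrow> (real \<Rightarrow> 'x) \<Rightarrow> bool) \<Rightarrow> ('x \<Rightarrow> 'u \<Rightarrow> real) \<Rightarrow>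
   'x \<Rightarrow> 'x \<Rightarrow> real \<Rightarrow> (real \<Rightarrow> 'u) \<Rightarrow> (real \<Rightarrow> 'x) \<Rightarrow> bool" where
  "ocp_feasible Uad Sol l x0 xT T u x \<longleftrightarrow>
     u \<in> Uad \<and> Sol T u x \<and> x 0 = x0 \<and> x T = xT \<and>
     set_integrable lebesgue {0..T} (\<lambda>t. l (x t) (u t))"

definition ocp_cost ::
  "('x \<Rightarrow> 'u \<Rightarrow> real) \<Rightarrow> real \<Rightarrow> (real \<Rightarrow> 'u) \<Rightarrow> (real \<Rightarrow> 'x) \<Rightarrow> real" where
  "ocp_cost l T u x = (LINT t:{0..T}|lebesgue. l (x t) (u t))"

definition ocp_optimal ::
  "(real \<Rightarrow> 'u) set \<Rightarrow> (real \<Rightarrow> (real \<Rightarrow> 'u) \<Rightarrow> (real \<Rightarrow> 'x) \<Rightarrow> bool) \<Rightarrow> ('x \<Rightarrow> 'u \<Rightarrow> real) \<Rightarrow>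
   'x \<Rightarrow> 'x \<Rightarrow> real \<Rightarrow> (real \<Rightarrow> 'u) \<Rightarrow> (real \<Rightarrow> 'x) \<Rightarrow> bool" where
  "ocp_optimal Uad Sol l x0 xT T u x \<longleftrightarrow>
     ocp_feasible Uad Sol l x0 xT T u x \<and>
     (\<forall>v z. ocp_feasible Uad Sol l x0 xT T v z \<longrightarrow> ocp_cost l T u x \<le> ocp_cost l T v z)"

(* Dissipativity with respect to M with storage function S. Nonnegativity of S is required along
   solutions only. Integrability is demanded explicitly because the Bochner integral of a
   non-integrable function is 0. *)
definition dissipative ::
  "(real \<Rightarrow> 'u) set \<Rightarrow> (real \<Rightarrow> (real \<Rightarrow> 'u) \<Rightarrow> (real \<Rightarrow> 'x) \<Rightarrow> bool) \<Rightarrow> ('x \<Rightarrow> 'u \<Rightarrow> real) \<Rightarrow>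
   'x \<Rightarrow> 'x \<Rightarrow> 'x::metric_space set \<Rightarrow> ('x \<Rightarrow> real) \<Rightarrow> bool" where
  "dissipative Uad Sol l x0 xT M S \<longleftrightarrow>
     (\<forall>T>0. \<forall>u\<in>Uad. \<forall>x. Sol T u x \<longrightarrow> (\<forall>t\<in>{0..T}. 0 \<le> S (x t))) \<and>
     (\<forall>C. compact C \<longrightarrow> bounded (S ` C)) \<and>
     (\<exists>\<alpha>\<in>class_K. \<forall>T>0. \<forall>u x. ocp_optimal Uad Sol l x0 xT T u x \<longrightarrow>
        set_integrable lebesgue {0..T} (\<lambda>t. l (x t) (u t) - \<alpha> (infdist (x t) M)) \<and>
        S xT - S x0 \<le> (LINT t:{0..T}|lebesgue. l (x t) (u t) - \<alpha> (infdist (x t) M)))"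

end

theory Submission
  imports Defs
begin

text \<open>
  The storage inequality holds with \<open>\<alpha> r = c\<^sup>2 r\<^sup>2\<close>: since \<open>R\<^sup>1\<^sup>/\<^sup>2\<close> is symmetric with square \<open>R\<close>, the
  dissipated power \<open>\<eta>\<^sup>T R \<eta>\<close> equals \<open>\<parallel>f\<parallel>\<^sup>2\<close>, which dominates \<open>c\<^sup>2 dist\<^sup>2\<close> on \<open>V\<close>, and it remains to
  integrate the power balance. The analytic content is the fundamental theorem of calculus for
  absolutely continuous functions, which also yields integrability of the dissipated power.
\<close>

section \<open>Spectral theorem and square roots\<close>

text \<open>\<open>v\<close> minimizes the nonnegative form \<open>x \<bullet> g x\<close> on
  \<open>W\<close>. A small step from \<open>v\<close> along \<open>- g v\<close>, which stays in
  \<open>W\<close> by invariance, would make the form negative to first order unless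
  \<open>g v = 0\<close>.\<close>

lemma psd_form_eq_0_imp:
  fixes g :: "'a::real_inner \<Rightarrow> 'a"
  assumes g: "linear g" "\<And>x y. x \<bullet> g y = g x \<bullet> y"
    and W: "subspace W" "\<And>x. x \<in> W \<Longrightarrow> g x \<in> W" "\<And>x. x \<in> W \<Longrightarrow> 0 \<le> x \<bullet> g x"
    and v: "v \<in> W" "v \<bullet> g v = 0"
  shows "g v = 0"
proof (rule ccontr)
  assume "g v \<noteq> 0"
  define z where "z = g v"
  have zz: "z \<bullet> z > 0" using \<open>g v \<noteq> 0\<close> by (simp add: z_def)
  have zW: "z \<in> W" using W v z_def by blast
  \<comment> \<open>Step length for which the second-order term is at most half of the first-order
    gain \<open>2 * (z \<bullet> z)\<close>; the \<open>+ 1\<close> keeps the denominator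
    positive.\<close>
  define s where "s = z \<bullet> z / (\<bar>z \<bullet> g z\<bar> + 1)"
  have s: "s > 0" using zz by (simp add: s_def)
  have "v - s *\<^sub>R z \<in> W" using W(1) v zW by (simp add: subspace_diff subspace_scale)
  then have "0 \<le> (v - s *\<^sub>R z) \<bullet> g (v - s *\<^sub>R z)" by (rule W(3))
  also have "g (v - s *\<^sub>R z) = z - s *\<^sub>R g z"
    using g(1) by (simp add: linear_diff linear_scale z_def)
  also have "(v - s *\<^sub>R z) \<bullet> (z - s *\<^sub>R g z) = s * (s * (z \<bullet> g z) - 2 * (z \<bullet> z))"
    using v(2) g(2)[of v z] by (simp add: z_def inner_diff algebra_simps inner_commute)
  finally have "2 * (z \<bullet> z) \<le> s * (z \<bullet> g z)" using s by (simp add: zero_le_mult_iff)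
  also have "\<dots> \<le> s * (\<bar>z \<bullet> g z\<bar> + 1)" using s by (intro mult_left_mono) auto
  also have "\<dots> = z \<bullet> z" by (simp add: s_def)
  finally show False using zz by simp
qed

text \<open>Rayleigh's principle: at a maximizer \<open>v\<close> of \<open>v \<bullet> f v\<close>
  on the compact unit sphere of \<open>W\<close>, with maximum \<open>\<mu>\<close>, the form of
  \<open>\<mu> - f\<close> is nonnegative on \<open>W\<close> and vanishes at \<open>v\<close>, so
  \<open>psd_form_eq_0_imp\<close> applies.\<close>

lemma selfadjoint_eigenvector_exists:
  fixes f :: "'a::euclidean_space \<Rightarrow> 'a"
  assumes f: "linear f" "\<And>x y. x \<bullet> f y = f x \<bullet> y"
    and W: "subspace W" "\<And>x. x \<in> W \<Longrightarrow> f x \<in> W" "W \<noteq> {0}"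
  obtains v \<mu> where "v \<in> W" "norm v = 1" "f v = \<mu> *\<^sub>R v"
proof -
  have "compact (W \<inter> sphere 0 1)"
    using W(1) closed_subspace by (intro closed_Int_compact) auto
  moreover have "W \<inter> sphere 0 1 \<noteq> {}"
  proof -
    obtain w where "w \<in> W" "w \<noteq> 0" using W subspace_0 by blast
    then have "(1 / norm w) *\<^sub>R w \<in> W \<inter> sphere 0 1" using W(1) by (simp add: subspace_scale)
    then show ?thesis by blast
  qed
  moreover have "continuous_on (W \<inter> sphere 0 1) (\<lambda>v. v \<bullet> f v)"
    using f(1) by (intro continuous_intros linear_continuous_on) (simp add: linear_linear)
  ultimately obtain v where v: "v \<in> W" "norm v = 1"
    and max: "\<And>w. w \<in> W \<Longrightarrow> norm w = 1 \<Longrightarrow> w \<bullet> f w \<le> v \<bullet> f v"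
    using continuous_attains_sup[of "W \<inter> sphere 0 1" "\<lambda>v. v \<bullet> f v"] by (metis Int_iff mem_sphere_0)
  define \<mu> where "\<mu> = v \<bullet> f v"
  define g where "g = (\<lambda>x. \<mu> *\<^sub>R x - f x)"
  have pos: "0 \<le> w \<bullet> g w" if "w \<in> W" for w
  proof (cases "w = 0")
    case False
    have "((1 / norm w) *\<^sub>R w) \<bullet> f ((1 / norm w) *\<^sub>R w) \<le> \<mu>"
      unfolding \<mu>_def using that False W(1) by (intro max) (auto simp: subspace_scale)
    then have "w \<bullet> f w \<le> \<mu> * (norm w)\<^sup>2"
      using False f(1) by (simp add: linear_scale field_simps power2_eq_square)
    then show ?thesis by (simp add: g_def inner_diff_right power2_norm_eq_inner)
  qed simp
  have "g v = 0"
  proof (rule psd_form_eq_0_imp[OF _ _ W(1) _ pos v(1)])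
    show "linear g" unfolding g_def
      using f(1) by (intro linear_compose_sub linear_compose_scale_right linear_ident)
    show "v \<bullet> g v = 0" using v(2) by (simp add: g_def \<mu>_def inner_diff_right norm_eq_1)
  qed (use f W in \<open>auto simp: g_def inner_diff subspace_diff subspace_scale\<close>)
  then have "f v = \<mu> *\<^sub>R v" by (simp add: g_def)
  with v that show thesis by blast
qed

text \<open>Induction on the dimension: an eigenvector is split off, and its orthogonal complement
  in \<open>W\<close> is again invariant because \<open>f\<close> is self-adjoint. General invariant
  subspaces are allowed so that the induction closes.\<close>

lemma selfadjoint_eigenbasis_subspace:
  fixes f :: "'a::euclidean_space \<Rightarrow> 'a"
  assumes f: "linear f" "\<And>x y. x \<bullet> f y = f x \<bullet> y"
    and "subspace W" "\<And>x. x \<in> W \<Longrightarrow> f x \<in> W"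
  shows "\<exists>B. pairwise orthogonal B \<and> (\<forall>b\<in>B. norm b = 1 \<and> (\<exists>\<mu>. f b = \<mu> *\<^sub>R b)) \<and> span B = W"
  using assms(3,4)
proof (induction "dim W" arbitrary: W rule: less_induct)
  case (less W)
  show ?case
  proof (cases "W = {0}")
    case True
    then show ?thesis by (intro exI[of _ "{}"]) auto
  next
    case False
    obtain v \<mu> where v: "v \<in> W" "norm v = 1" "f v = \<mu> *\<^sub>R v"
      using selfadjoint_eigenvector_exists[OF f less.prems False] by blast
    \<comment> \<open>Orthogonality to all of \<open>span {v}\<close> is the shape in which
      \<open>dim_subspace_orthogonal_to_vectors\<close> counts dimensions; the fact \<open>X\<close>
      below reduces it to \<open>v\<close> alone.\<close>
    define X where "X = {y \<in> W. \<forall>x \<in> span {v}. orthogonal x y}"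
    have X: "x \<in> X \<longleftrightarrow> x \<in> W \<and> v \<bullet> x = 0" for x
      by (auto simp: X_def span_singleton orthogonal_def intro: exI[of _ 1])
    have "dim X + dim (span {v}) = dim W"
      unfolding X_def by (rule dim_subspace_orthogonal_to_vectors)
        (use v less.prems in \<open>auto simp: span_minimal\<close>)
    moreover have "dim (span {v}) = 1"
      using v(2) by (simp add: dim_insert) auto
    ultimately have "dim X < dim W" by simp
    moreover have "subspace X"
      using less.prems(1) unfolding subspace_def by (auto simp: X inner_add_right)
    moreover have "f x \<in> X" if "x \<in> X" for x
      using that less.prems v(3) f(2)[of v x] by (simp add: X)
    ultimately obtain B where B: "pairwise orthogonal B"
      "\<forall>b\<in>B. norm b = 1 \<and> (\<exists>\<mu>. f b = \<mu> *\<^sub>R b)" "span B = X"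
      using less.hyps by blast
    have BX: "B \<subseteq> X" using B(3) span_superset by blast
    have "pairwise orthogonal (insert v B)"
      using B(1) BX by (auto simp: pairwise_insert X orthogonal_def inner_commute)
    moreover have "span (insert v B) = W"
    proof
      show "span (insert v B) \<subseteq> W"
        using v(1) BX less.prems(1) by (intro span_minimal) (auto simp: X)
      show "W \<subseteq> span (insert v B)"
      proof
        fix w assume "w \<in> W"
        then have "w - (v \<bullet> w) *\<^sub>R v \<in> span B"
          using v less.prems(1)
          by (simp add: B(3) X subspace_diff subspace_scale inner_diff_right norm_eq_1)
        then show "w \<in> span (insert v B)" by (auto simp: span_insert)
      qed
    qed
    ultimately show ?thesis using B(2) v by (intro exI[of _ "insert v B"]) auto
  qed
qed

lemma selfadjoint_eigenbasis:
  fixes f :: "'a::euclidean_space \<Rightarrow> 'a"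
  assumes "linear f" "\<And>x y. x \<bullet> f y = f x \<bullet> y"
  obtains B \<mu> where "finite B" "pairwise orthogonal B" "\<And>b. b \<in> B \<Longrightarrow> norm b = 1"
    "\<And>b. b \<in> B \<Longrightarrow> f b = \<mu> b *\<^sub>R b" "span B = UNIV"
proof -
  obtain B where B: "pairwise orthogonal B" "\<forall>b\<in>B. norm b = 1 \<and> (\<exists>\<mu>. f b = \<mu> *\<^sub>R b)" "span B = UNIV"
    using selfadjoint_eigenbasis_subspace[OF assms, of UNIV] by auto
  from B(2) obtain \<mu> where "\<And>b. b \<in> B \<Longrightarrow> f b = \<mu> b *\<^sub>R b" by metis
  then show thesis using B that[of B \<mu>] by (simp add: pairwise_orthogonal_imp_finite)
qed

section \<open>Symmetric matrices and the positive semidefinite square root\<close>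

lemma symmetric_matrix_inner:
  fixes A :: "real^'n^'n"
  assumes "transpose A = A"
  shows "x \<bullet> (A *v y) = (A *v x) \<bullet> y"
  by (metis assms dot_lmul_matrix transpose_matrix_vector)

lemma symmetric_matrixI:
  fixes A :: "real^'n^'n"
  assumes "\<And>x y. x \<bullet> (A *v y) = (A *v x) \<bullet> y"
  shows "transpose A = A"
proof -
  have "x \<bullet> (transpose A *v y) = x \<bullet> (A *v y)" for x y
    by (metis assms dot_lmul_matrix inner_commute transpose_matrix_vector)
  then show ?thesis by (metis matrix_eq vector_eq_ldot)
qed

lemma psd_matrix_vector_eq_0:
  assumes "psd A" "v \<bullet> (A *v v) = 0"
  shows "A *v v = 0"
proof (rule psd_form_eq_0_imp[where g = "(*v) A" and W = UNIV])
  show "x \<bullet> (A *v y) = (A *v x) \<bullet> y" for x y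
    using assms(1) symmetric_matrix_inner unfolding psd_def by blast
qed (use assms in \<open>auto simp: psd_def\<close>)

text \<open>In an orthonormal eigenbasis, each eigenvalue is replaced by its square root.\<close>

lemma psd_sqrt_exists:
  fixes A :: "real^'n^'n"
  assumes "psd A"
  shows "\<exists>S. psd S \<and> S ** S = A"
proof -
  have sym: "x \<bullet> (A *v y) = (A *v x) \<bullet> y" for x y
    using assms symmetric_matrix_inner unfolding psd_def by blast
  obtain B \<mu> where B: "finite B" "pairwise orthogonal B" "\<And>b. b \<in> B \<Longrightarrow> norm b = 1"
    and ev: "\<And>b. b \<in> B \<Longrightarrow> A *v b = \<mu> b *\<^sub>R b" and span: "span B = UNIV"
    using selfadjoint_eigenbasis[of "(*v) A"] sym by (metis matrix_vector_mul_linear)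
  have nonneg: "\<mu> b \<ge> 0" if "b \<in> B" for b
  proof -
    have "0 \<le> b \<bullet> (A *v b)" using assms by (simp add: psd_def)
    then show ?thesis using that B(3) by (simp add: ev norm_eq_1)
  qed
  define g where "g = (\<lambda>v. \<Sum>b\<in>B. (sqrt (\<mu> b) * (b \<bullet> v)) *\<^sub>R b)"
  have lin: "linear g"
    unfolding g_def by (intro linearI)
      (auto simp: inner_add_right scaleR_add_left sum.distrib scaleR_sum_right algebra_simps)
  define S where "S = matrix g"
  have S: "S *v v = g v" for v by (simp add: S_def matrix_works lin linear_linear)
  have gb: "g b = sqrt (\<mu> b) *\<^sub>R b" if "b \<in> B" for b
  proof -
    have "g b = (\<Sum>a\<in>B. if a = b then sqrt (\<mu> b) *\<^sub>R b else 0)"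
      unfolding g_def using that B(2,3)
      by (intro sum.cong) (auto simp: pairwise_def orthogonal_def norm_eq_1)
    then show ?thesis using that B(1) by simp
  qed
  \<comment> \<open>The diagonal form of the bilinear form of \<open>g\<close> shows both its
    symmetry and its nonnegativity.\<close>
  have inner_g: "x \<bullet> g y = (\<Sum>b\<in>B. sqrt (\<mu> b) * (b \<bullet> x) * (b \<bullet> y))" for x y
    by (auto simp: g_def inner_sum_right inner_commute intro!: sum.cong)
  have "transpose S = S"
    by (rule symmetric_matrixI)
      (simp add: S inner_g inner_commute[of "g _"] mult_ac)
  moreover have "0 \<le> v \<bullet> (S *v v)" for v
    unfolding S inner_g mult.assoc
    by (intro sum_nonneg mult_nonneg_nonneg[OF _ zero_le_square]) (simp add: nonneg)
  moreover have "S ** S = A"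
  proof -
    have "(S ** S) *v v = A *v v" for v
    proof (rule linear_eq_on_span[of "(*v) (S ** S)" "(*v) A" B])
      show "(S ** S) *v b = A *v b" if "b \<in> B" for b
        using that by (simp add: matrix_vector_mul_assoc[symmetric] S gb ev nonneg
            linear_scale[OF lin])
    qed (use span in auto)
    then show ?thesis by (simp add: matrix_eq)
  qed
  ultimately show ?thesis by (auto simp: psd_def)
qed

text \<open>The difference \<open>D = S - T\<close> is symmetric, so it suffices that it kills each
  of its eigenvectors. This is shown without first proving that \<open>S\<close> and
  \<open>T\<close> commute.\<close>

lemma psd_sqrt_unique:
  fixes S T :: "real^'n^'n"
  assumes "psd S" "psd T" "S ** S = T ** T"
  shows "S = T"
proof -
  define D where "D = S - T"
  have sym: "transpose S = S" "transpose T = T"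
    and nonneg: "0 \<le> v \<bullet> (S *v v)" "0 \<le> v \<bullet> (T *v v)" for v
    using assms by (auto simp: psd_def)
  have D: "D *v v = S *v v - T *v v" for v
    by (simp add: D_def matrix_vector_mult_diff_rdistrib)
  have symD: "x \<bullet> (D *v y) = (D *v x) \<bullet> y" for x y
    by (simp add: D inner_diff symmetric_matrix_inner[OF sym(1)] symmetric_matrix_inner[OF sym(2)])
  obtain B \<mu> where ev: "\<And>b. b \<in> B \<Longrightarrow> D *v b = \<mu> b *\<^sub>R b" and span: "span B = UNIV"
    using selfadjoint_eigenbasis[of "(*v) D"] symD by (metis matrix_vector_mul_linear)
  have "D *v b = 0" if "b \<in> B" for b
  proof (cases "\<mu> b = 0")
    case False
    \<comment> \<open>The noncommutative identity \<open>S (S - T) + (S - T) T = S S - T T\<close>.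
      Tested against \<open>b\<close>, it yields \<open>\<mu> b\<close> times a sum of two
      nonnegative forms, both of which must vanish; hence \<open>S\<close> and \<open>T\<close> both
      kill \<open>b\<close>.\<close>
    have "S *v (D *v b) + D *v (T *v b) = (S ** S) *v b - (T ** T) *v b"
      by (simp add: D matrix_vector_mult_diff_distrib flip: matrix_vector_mul_assoc)
    then have "b \<bullet> (S *v (D *v b)) + b \<bullet> (D *v (T *v b)) = 0"
      using assms(3) by (metis diff_self inner_add_right inner_zero_right)
    then have "\<mu> b * (b \<bullet> (S *v b) + b \<bullet> (T *v b)) = 0"
      by (simp add: symD ev[OF that] matrix_vector_mult_scaleR algebra_simps)
    then have "b \<bullet> (S *v b) = 0" "b \<bullet> (T *v b) = 0"
      using False nonneg[of b] by (auto simp: add_nonneg_eq_0_iff)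
    then show ?thesis using assms by (simp add: D psd_matrix_vector_eq_0)
  qed (simp add: ev that)
  then have "D *v v = 0 *v v" for v
    using linear_eq_on_span[of "(*v) D" "(*v) 0" B v] span by simp
  then have "D = 0" by (simp add: matrix_eq)
  then show ?thesis by (simp add: D_def)
qed

lemma psd_sqrt:
  assumes "psd A"
  shows "psd (psd_sqrt A)" "psd_sqrt A ** psd_sqrt A = A"
proof -
  have "\<exists>!S. psd S \<and> S ** S = A"
    using psd_sqrt_exists[OF assms] psd_sqrt_unique by metis
  from theI'[OF this] show "psd (psd_sqrt A)" "psd_sqrt A ** psd_sqrt A = A"
    by (auto simp: psd_sqrt_def)
qed

lemma norm_psd_sqrt_mult:
  assumes "psd A"
  shows "(norm (psd_sqrt A *v v))\<^sup>2 = v \<bullet> (A *v v)"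
proof -
  have "transpose (psd_sqrt A) = psd_sqrt A" using psd_sqrt[OF assms] by (simp add: psd_def)
  from symmetric_matrix_inner[OF this, of v "psd_sqrt A *v v"] show ?thesis
    by (simp add: power2_norm_eq_inner matrix_vector_mul_assoc psd_sqrt[OF assms])
qed

section \<open>The fundamental theorem of calculus for absolutely continuous functions\<close>

text \<open>Lets a cover of small measure meet the length condition in
  \<open>abs_continuous\<close>. The intervals are treated as a family indexed by \<open>D\<close>,
  so repeated empty intervals from degenerate pairs are harmless.\<close>

lemma sum_lengths_le_measure:
  fixes U :: "real set"
  assumes "finite D" "\<And>s t. (s, t) \<in> D \<Longrightarrow> s \<le> t \<and> {s<..<t} \<subseteq> U" "U \<in> lmeasurable"
    and "pairwise (\<lambda>(s,t) (s',t'). {s<..<t} \<inter> {s'<..<t'} = {}) D"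
  shows "(\<Sum>(s,t)\<in>D. t - s) \<le> measure lebesgue U"
proof -
  let ?I = "\<lambda>(s,t). {s<..<t} :: real set"
  have "(\<Sum>(s,t)\<in>D. t - s) = (\<Sum>d\<in>D. measure lebesgue (?I d))"
    using assms(2) by (intro sum.cong) auto
  also have "\<dots> = measure lebesgue (\<Union>(?I ` D))"
  proof (rule measure_finite_Union[symmetric])
    show "?I ` D \<subseteq> sets lebesgue" by auto
    show "disjoint_family_on ?I D"
      using assms(4) by (fastforce simp: disjoint_family_on_def pairwise_def)
    show "emeasure lebesgue (?I d) \<noteq> \<infinity>" if "d \<in> D" for d
      using assms(2) that by (cases d) auto
  qed (use assms in auto)
  also have "\<dots> \<le> measure lebesgue U"
    using assms(2,3) by (intro measure_mono_fmeasurable) (auto intro!: sets.finite_UN assms(1))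
  finally show ?thesis .
qed

text \<open>Works with gauge Riemann sums. At tags off \<open>N\<close>, differentiability makes
  each term close to the increment of \<open>h\<close>; at tags in \<open>N\<close>, the gauge
  forces the intervals into an open set of small measure, where absolute continuity makes the
  increments small in total.\<close>

lemma has_integral_abs_continuous:
  fixes h h' :: "real \<Rightarrow> real"
  assumes "a \<le> b" and ac: "abs_continuous a b h" and N: "negligible N"
    and deriv: "\<And>x. x \<in> {a..b} - N \<Longrightarrow> (h has_real_derivative h' x) (at x within {a..b})"
  shows "(h' has_integral h b - h a) {a..b}"
proof -
  \<comment> \<open>Nothing is known about \<open>h'\<close> on \<open>N\<close>; with the value 0
    there, tags in \<open>N\<close> contribute only increments of \<open>h\<close>. The final spike
    step returns to \<open>h'\<close>.\<close>
  define g where "g x = (if x \<in> N then 0 else h' x)" for x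
  have "(g has_integral h b - h a) {a..b}"
    unfolding has_integral_real
  proof (intro allI impI)
    fix e :: real assume "e > 0"
    \<comment> \<open>Half of \<open>e\<close> is reserved for each kind of tag; the
      \<open>+ 1\<close> covers \<open>a = b\<close> and makes \<open>e1b\<close> strict.\<close>
    define e1 where "e1 = e / (2 * (b - a + 1))"
    have e1: "e1 > 0" using \<open>e > 0\<close> \<open>a \<le> b\<close> by (simp add: e1_def)
    have e1b: "e1 * (b - a) < e / 2"
      using \<open>e > 0\<close> \<open>a \<le> b\<close> by (simp add: e1_def field_simps)
    obtain \<delta> where "\<delta> > 0" and \<delta>: "\<And>D. \<lbrakk>finite D; \<forall>(s,t)\<in>D. a \<le> s \<and> s \<le> t \<and> t \<le> b;
        pairwise (\<lambda>(s,t) (s',t'). {s<..<t} \<inter> {s'<..<t'} = {}) D; (\<Sum>(s,t)\<in>D. t - s) < \<delta>\<rbrakk>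
        \<Longrightarrow> (\<Sum>(s,t)\<in>D. \<bar>h t - h s\<bar>) < e / 2"
    proof -
      have "e / 2 > 0" using \<open>e > 0\<close> by simp
      then obtain \<delta> where "\<delta> > 0" and "\<forall>D. finite D \<and> (\<forall>(s,t)\<in>D. a \<le> s \<and> s \<le> t \<and> t \<le> b) \<and>
          pairwise (\<lambda>(s,t) (s',t'). {s<..<t} \<inter> {s'<..<t'} = {}) D \<and>
          (\<Sum>(s,t)\<in>D. t - s) < \<delta> \<longrightarrow> (\<Sum>(s,t)\<in>D. \<bar>h t - h s\<bar>) < e / 2"
        using ac unfolding abs_continuous_def by blast
      then show thesis by (intro that[of \<delta>]) auto
    qed
    \<comment> \<open>Membership of \<open>x\<close> stands under the existential so that the chosen
      radius \<open>d\<close> is positive everywhere.\<close>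
    have "\<forall>x. \<exists>d>0. x \<in> {a..b} - N \<longrightarrow>
        (\<forall>y\<in>{a..b}. norm (y - x) < d \<longrightarrow> norm (h y - h x - h' x * (y - x)) \<le> e1 * norm (y - x))"
    proof
      fix x
      show "\<exists>d>0. x \<in> {a..b} - N \<longrightarrow>
        (\<forall>y\<in>{a..b}. norm (y - x) < d \<longrightarrow> norm (h y - h x - h' x * (y - x)) \<le> e1 * norm (y - x))"
      proof (cases "x \<in> {a..b} - N")
        case True
        then show ?thesis
          using deriv[OF True] e1 unfolding has_field_derivative_def has_derivative_within_alt by blast
      qed (auto intro: exI[of _ 1])
    qed
    then obtain d where d: "\<And>x. d x > 0"
      "\<And>x y. \<lbrakk>x \<in> {a..b} - N; y \<in> {a..b}; \<bar>y - x\<bar> < d x\<rbrakk> \<Longrightarrow> \<bar>h y - h x - h' x * (y - x)\<bar> \<le> e1 * \<bar>y - x\<bar>"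
      unfolding real_norm_def by metis
    obtain U where U: "open U" "N \<subseteq> U" "U \<in> lmeasurable" "measure lebesgue U < \<delta>"
    proof -
      have null: "N \<in> null_sets lebesgue" using N by (simp add: negligible_iff_null_sets)
      \<comment> \<open>Outer regularity bounds \<open>U - N\<close>; since \<open>N\<close> is
        null, the same bound holds for \<open>U\<close>.\<close>
      obtain U where U: "open U" "N \<subseteq> U" "U - N \<in> lmeasurable" "emeasure lebesgue (U - N) < ennreal \<delta>"
        using sets_lebesgue_outer_open[of N \<delta>] null \<open>\<delta> > 0\<close> by blast
      have Us: "U \<in> sets lebesgue" using U(1) by simp
      have "emeasure lebesgue U = emeasure lebesgue (U - N)"
        using emeasure_Diff_null_set[OF null Us] by simp
      then have "U \<in> lmeasurable" "measure lebesgue U < \<delta>"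
        using U(3,4) Us \<open>\<delta> > 0\<close>
        by (auto simp: fmeasurable_def measure_def enn2real_less_iff)
      with U that show thesis by blast
    qed
    define \<gamma> where "\<gamma> x = (if x \<in> N then U else ball x (d x))" for x
    have "gauge \<gamma>" using U d(1) by (auto simp: gauge_def \<gamma>_def)
    moreover have "norm ((\<Sum>(x, K)\<in>p. measure lborel K *\<^sub>R g x) - (h b - h a)) < e"
      if p: "p tagged_division_of {a..b}" and fine: "\<gamma> fine p" for p
    proof -
      have fin: "finite p" using p by blast
      have ab: "b - a = (\<Sum>(x,K)\<in>p. Sup K - Inf K)" "h b - h a = (\<Sum>(x,K)\<in>p. h (Sup K) - h (Inf K))"
        using additive_tagged_division_1[OF \<open>a \<le> b\<close> p, of "\<lambda>x. x"]
          additive_tagged_division_1[OF \<open>a \<le> b\<close> p, of h] by auto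
      have K: "K = {Inf K..Sup K} \<and> x \<in> K \<and> Inf K \<le> x \<and> x \<le> Sup K \<and> a \<le> Inf K \<and> Sup K \<le> b \<and> K \<subseteq> \<gamma> x"
        if "(x, K) \<in> p" for x K
      proof -
        obtain u v where uv: "K = cbox u v" using tagged_division_ofD(4)[OF p \<open>(x, K) \<in> p\<close>] by blast
        have "x \<in> K" "K \<subseteq> {a..b}"
          using tagged_division_ofD(2,3)[OF p \<open>(x, K) \<in> p\<close>] by auto
        moreover have "K \<subseteq> \<gamma> x" using fine that by blast
        ultimately show ?thesis using uv by auto
      qed
      define r where "r = (\<lambda>(x, K). measure lborel K *\<^sub>R g x - (h (Sup K) - h (Inf K)))"
      define p1 where "p1 = {(x, K) \<in> p. x \<notin> N}"
      define p2 where "p2 = {(x, K) \<in> p. x \<in> N}"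
      have "(\<Sum>(x, K)\<in>p. measure lborel K *\<^sub>R g x) - (h b - h a) = sum r p"
        by (simp add: ab(2) r_def case_prod_unfold sum_subtractf)
      also have "\<dots> = sum r (p1 \<union> p2)"
        by (rule arg_cong[where f = "sum r"]) (auto simp: p1_def p2_def)
      also have "\<dots> = sum r p1 + sum r p2"
        by (rule sum.union_disjoint) (auto simp: p1_def p2_def intro: finite_subset[OF _ fin])
      finally have split: "(\<Sum>(x, K)\<in>p. measure lborel K *\<^sub>R g x) - (h b - h a) = sum r p1 + sum r p2" .
      have "\<bar>sum r p1\<bar> \<le> (\<Sum>(x,K)\<in>p1. e1 * (Sup K - Inf K))"
      proof (rule order_trans[OF sum_abs sum_mono])
        fix y assume "y \<in> p1"
        then obtain x K where y: "y = (x, K)" "(x, K) \<in> p" "x \<notin> N" by (auto simp: p1_def)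
        note KK = K[OF y(2)]
        have "Inf K \<in> K" "Sup K \<in> K" using KK by (metis atLeastAtMost_iff order_refl order_trans)+
        then have near: "\<bar>Inf K - x\<bar> < d x" "\<bar>Sup K - x\<bar> < d x"
          using KK y(3) by (auto simp: \<gamma>_def subset_iff dist_real_def abs_minus_commute)
        have x: "x \<in> {a..b} - N" and ends: "Inf K \<in> {a..b}" "Sup K \<in> {a..b}"
          and order: "Inf K \<le> x" "x \<le> Sup K"
          using KK y(3) by auto
        \<comment> \<open>Straddling: the tag lies between the endpoints, so the two one-sided
          errors add up to \<open>e1\<close> times the full length.\<close>
        have "\<bar>h (Inf K) - h x - h' x * (Inf K - x)\<bar> \<le> e1 * (x - Inf K)"
          "\<bar>h (Sup K) - h x - h' x * (Sup K - x)\<bar> \<le> e1 * (Sup K - x)"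
          using d(2)[OF x ends(1) near(1)] d(2)[OF x ends(2) near(2)] order by simp_all
        then have "\<bar>(Sup K - Inf K) * h' x - (h (Sup K) - h (Inf K))\<bar> \<le> e1 * (Sup K - Inf K)"
          by (simp add: algebra_simps)
        moreover have "measure lborel K = Sup K - Inf K" using KK by (metis content_real order_trans)
        ultimately show "\<bar>r y\<bar> \<le> (case y of (x, K) \<Rightarrow> e1 * (Sup K - Inf K))"
          using y(3) by (simp add: r_def y(1) g_def)
      qed
      also have "\<dots> \<le> (\<Sum>(x,K)\<in>p. e1 * (Sup K - Inf K))"
        using fin K e1 by (intro sum_mono2) (fastforce simp: p1_def)+
      also have "\<dots> = e1 * (b - a)" by (simp add: ab(1) sum_distrib_left case_prod_unfold)
      finally have good: "\<bar>sum r p1\<bar> < e / 2" using e1b by simp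
      \<comment> \<open>\<open>abs_continuous\<close> speaks of sets of endpoint pairs, so the tags
        have to be forgotten.\<close>
      define J where "J = (\<lambda>(x::real, K). (Inf K :: real, Sup K :: real))"
      define D where "D = J ` p2"
      have disj: "{Inf K<..<Sup K} \<inter> {Inf K'<..<Sup K'} = {}"
        if "(x, K) \<in> p" "(x', K') \<in> p" "(x, K) \<noteq> (x', K')" for x K x' K'
        using tagged_division_ofD(5)[OF p that] K[OF that(1)] K[OF that(2)]
        by (metis interior_atLeastAtMost_real)
      \<comment> \<open>No increment is lost in passing to endpoint pairs: equal nondegenerate
        intervals would violate disjointness of interiors, and a degenerate interval is a single
        point, which is its tag.\<close>
      have inj: "inj_on J p2"
      proof (rule inj_onI, clarsimp simp: J_def p2_def)
        fix x K x' K'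
        assume A: "(x, K) \<in> p" "(x', K') \<in> p" "Inf K = Inf K'" "Sup K = Sup K'"
        show "x = x' \<and> K = K'"
        proof (cases "Inf K < Sup K")
          case True
          then show ?thesis using disj[OF A(1,2)] A(3,4) by fastforce
        next
          case False
          then show ?thesis using K[OF A(1)] K[OF A(2)] A(3,4) by (metis order_antisym not_less order_trans)
        qed
      qed
      have "(\<Sum>(s,t)\<in>D. \<bar>h t - h s\<bar>) < e / 2"
      proof (rule \<delta>)
        show "finite D" using fin by (auto simp: D_def p2_def intro: finite_subset[OF _ fin])
        show "\<forall>(s,t)\<in>D. a \<le> s \<and> s \<le> t \<and> t \<le> b"
          using K by (fastforce simp: D_def J_def p2_def)
        show pw: "pairwise (\<lambda>(s,t) (s',t'). {s<..<t} \<inter> {s'<..<t'} = {}) D"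
          unfolding D_def
        proof (rule pairwise_imageI)
          fix y y' assume y: "y \<in> p2" "y' \<in> p2" "y \<noteq> y'"
          obtain x K x' K' where "y = (x, K)" "y' = (x', K')" by (cases y; cases y')
          then show "(\<lambda>(s,t) (s',t'). {s<..<t} \<inter> {s'<..<t'} = {}) (J y) (J y')"
            using disj[of x K x' K'] y by (simp add: J_def p2_def)
        qed
        have "(\<Sum>(s,t)\<in>D. t - s) \<le> measure lebesgue U"
        proof (rule sum_lengths_le_measure[OF \<open>finite D\<close> _ U(3) pw])
          fix s t assume "(s, t) \<in> D"
          then obtain x K where x: "(x, K) \<in> p" "x \<in> N" "s = Inf K" "t = Sup K"
            by (auto simp: D_def J_def p2_def)
          have "{Inf K..Sup K} \<subseteq> U" using K[OF x(1)] x(2) by (simp add: \<gamma>_def)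
          then show "s \<le> t \<and> {s<..<t} \<subseteq> U"
            using K[OF x(1)] by (auto simp: x(3,4))
        qed
        then show "(\<Sum>(s,t)\<in>D. t - s) < \<delta>" using U(4) by linarith
      qed
      moreover have "(\<Sum>(s,t)\<in>D. \<bar>h t - h s\<bar>) = (\<Sum>y\<in>p2. \<bar>r y\<bar>)"
        unfolding D_def sum.reindex[OF inj]
        by (intro sum.cong) (auto simp: J_def r_def p2_def g_def)
      ultimately have "\<bar>sum r p2\<bar> < e / 2" using sum_abs[of r p2] by linarith
      then show ?thesis using good split by simp
    qed
    ultimately show "\<exists>\<gamma>. gauge \<gamma> \<and> (\<forall>\<D>. \<D> tagged_division_of {a..b} \<and> \<gamma> fine \<D> \<longrightarrow>
        norm ((\<Sum>(x, k)\<in>\<D>. measure lborel k *\<^sub>R g x) - (h b - h a)) < e)"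
      by (intro exI[of _ \<gamma>]) simp
  qed
  then show ?thesis by (rule has_integral_spike[OF N, rotated]) (simp add: g_def)
qed

section \<open>Dissipativity\<close>

lemma AE_lebesgue_negligible:
  assumes "AE t\<in>S in lebesgue. P t"
  obtains N where "negligible N" "\<And>t. t \<in> S - N \<Longrightarrow> P t"
proof -
  from assms obtain N where "\<And>t. t \<in> space lebesgue - N \<Longrightarrow> t \<in> S \<longrightarrow> P t" "N \<in> null_sets lebesgue"
    by (rule AE_E3) blast
  then show thesis by (intro that[of N]) (auto simp: negligible_iff_null_sets)
qed

text \<open>Supplies measurability along trajectories that may jump: continuity of the restriction
  to \<open>S - N\<close> gives measurability there, and changes on a negligible set do not affect
  it.\<close>

lemma borel_measurable_lebesgue_on_continuous_off_negligible:
  fixes f :: "'a::euclidean_space \<Rightarrow> 'b::euclidean_space"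
  assumes S: "S \<in> sets lebesgue" and "negligible N" "continuous_on (S - N) f"
  shows "f \<in> borel_measurable (lebesgue_on S)"
proof -
  have meas: "S - N \<in> sets lebesgue"
    using S negligible_imp_sets[OF \<open>negligible N\<close>] by blast
  have "f measurable_on (S - N)"
    using continuous_imp_measurable_on_sets_lebesgue[OF assms(3) meas]
    by (simp add: measurable_on_iff_borel_measurable meas)
  then have "f measurable_on S"
    by (rule measurable_on_spike_set)
      (auto intro: negligible_subset[OF \<open>negligible N\<close>])
  then show ?thesis by (simp add: measurable_on_iff_borel_measurable S)
qed

theorem theorem12:
  fixes E J R :: "real^'n \<Rightarrow> real^'n^'n"
    and \<eta> :: "real^'n \<Rightarrow> real^'n"
    and B :: "real^'n \<Rightarrow> real^'m^'n"
    and H :: "real^'n \<Rightarrow> real"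
    and Uad :: "(real \<Rightarrow> real^'m) set"
    and Sol :: "real \<Rightarrow> (real \<Rightarrow> real^'m) \<Rightarrow> (real \<Rightarrow> real^'n) \<Rightarrow> bool"
    and K M G V :: "(real^'n) set"
    and x0 xT :: "real^'n"
    and f :: "real^'n \<Rightarrow> real^'n"
    and s :: nat
    and c c' :: real
  assumes pH: "port_hamiltonian E J R \<eta> B H Uad Sol"
    and "compact K" "x0 \<in> K" "xT \<in> K"
    and optimal_exists:
      "\<And>T. T > 0 \<Longrightarrow> \<exists>u x. ocp_optimal Uad Sol (supplied_power B \<eta>) x0 xT T u x"
    and f_def: "f = (\<lambda>x. psd_sqrt (R x) *v \<eta> x)"
    and M_def: "M = {x. f x = 0}"
    and A1: "C2_map f"
    and A2: "M \<noteq> {}" "open G" "M \<subseteq> G" "0 < s" "s < CARD('n)"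
      "\<And>x. x \<in> G \<Longrightarrow> dim {v. frechet_derivative f (at x) v = 0} = s"
    and A3: "c' > 0"
      "\<And>x. x \<in> G \<Longrightarrow> c' \<le> smallest_nonzero_singular_value (jacobian f (at x))"
    and A4: "open V" "M \<subseteq> V" "V \<subseteq> interior (unpp M)"
      "c > 0" "\<And>x. x \<in> V \<Longrightarrow> c * infdist x M \<le> norm (f x)"
      "\<And>T u x t. \<lbrakk>T > 0; ocp_optimal Uad Sol (supplied_power B \<eta>) x0 xT T u x; t \<in> {0..T}\<rbrakk>
         \<Longrightarrow> x t \<in> V"
  shows "dissipative Uad Sol (supplied_power B \<eta>) x0 xT M H"
proof -
  interpret port_hamiltonian E J R \<eta> B H Uad Sol by (rule pH)
  define \<alpha> where "\<alpha> r = (c * r)\<^sup>2" for r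
  have \<alpha>: "\<alpha> \<in> class_K"
  proof -
    have "strict_mono_on {0..} \<alpha>"
      using \<open>c > 0\<close> by (intro strict_mono_onI) (auto simp: \<alpha>_def intro!: power_strict_mono)
    moreover have "continuous_on {0..} \<alpha>" unfolding \<alpha>_def by (intro continuous_intros)
    ultimately show ?thesis by (simp add: class_K_def \<alpha>_def)
  qed
  have "isCont H x" for x
    using C1_H has_derivative_continuous unfolding C1_map_def by blast
  then have contH: "continuous_on S H" for S by (simp add: continuous_at_imp_continuous_on)
  have bounded: "bounded (H ` C)" if "compact C" for C
    using that contH compact_continuous_image compact_imp_bounded by blast
  \<comment> \<open>\<open>\<alpha>\<close> depends on \<open>c\<close> only, so one comparison
    function serves all horizons and all optimal pairs.\<close>
  have "set_integrable lebesgue {0..T} (\<lambda>t. supplied_power B \<eta> (x t) (u t) - \<alpha> (infdist (x t) M)) \<and>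
      H xT - H x0 \<le> (LINT t:{0..T}|lebesgue. supplied_power B \<eta> (x t) (u t) - \<alpha> (infdist (x t) M))"
    if "T > 0" and opt: "ocp_optimal Uad Sol (supplied_power B \<eta>) x0 xT T u x" for T u x
  proof -
    define p where "p t = supplied_power B \<eta> (x t) (u t)" for t
    define q where "q t = \<eta> (x t) \<bullet> (R (x t) *v \<eta> (x t))" for t
    define a where "a t = \<alpha> (infdist (x t) M)" for t
    from opt have "u \<in> Uad" "Sol T u x" and bv: "x 0 = x0" "x T = xT"
      and p: "set_integrable lebesgue {0..T} p"
      by (auto simp: ocp_optimal_def ocp_feasible_def p_def[abs_def])
    then have sol: "ph_solution E J R \<eta> B H T u x" using Sol \<open>T > 0\<close> by blast
    then have "AE t\<in>{0..T} in lebesgue. \<exists>x'. (x has_vector_derivative x') (at t within {0..T}) \<and>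
        E (x t) *v x' = (J (x t) - R (x t)) *v \<eta> (x t) + B (x t) *v u t"
      unfolding ph_solution_def by blast
    then obtain N1 where N1: "negligible N1"
      "\<And>t. t \<in> {0..T} - N1 \<Longrightarrow> \<exists>x'. (x has_vector_derivative x') (at t within {0..T})"
      by (rule AE_lebesgue_negligible) blast
    from sol have "AE t\<in>{0..T} in lebesgue.
        ((\<lambda>t. H (x t)) has_real_derivative - q t + p t) (at t within {0..T})"
      unfolding ph_solution_def q_def p_def supplied_power_def by blast
    then obtain N2 where N2: "negligible N2"
      "\<And>t. t \<in> {0..T} - N2 \<Longrightarrow> ((\<lambda>t. H (x t)) has_real_derivative - q t + p t) (at t within {0..T})"
      by (rule AE_lebesgue_negligible) blast
    have ac: "abs_continuous 0 T (\<lambda>t. H (x t))" using sol by (simp add: ph_solution_def)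
    have "((\<lambda>t. - q t + p t) has_integral H xT - H x0) {0..T}"
      using has_integral_abs_continuous[OF _ ac N2] \<open>T > 0\<close> bv by simp
    \<comment> \<open>Feasibility makes the supplied power \<open>p\<close> integrable; subtracting
      the integrated power balance isolates the dissipated power \<open>q\<close>, whose
      integrability thus comes as a result.\<close>
    from has_integral_diff[OF has_integral_set_lebesgue[OF p] this]
    have q: "(q has_integral (LINT t:{0..T}|lebesgue. p t) - (H xT - H x0)) {0..T}" by simp
    \<comment> \<open>Differentiability off \<open>N1\<close> is what makes the distance term
      \<open>a\<close> measurable.\<close>
    have "continuous_on ({0..T} - N1) x"
      unfolding continuous_on_eq_continuous_within
      using N1(2) has_vector_derivative_continuous continuous_within_subset Diff_subset by metis
    then have "continuous_on ({0..T} - N1) a"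
      unfolding a_def \<alpha>_def by (intro continuous_intros)
    then have meas: "a \<in> borel_measurable (lebesgue_on {0..T})"
      using N1(1) by (intro borel_measurable_lebesgue_on_continuous_off_negligible) auto
    have aq: "a t \<le> q t" if "t \<in> {0..T}" for t
    proof -
      have "c * infdist (x t) M \<le> norm (f (x t))" using A4 \<open>T > 0\<close> opt that by blast
      then have "a t \<le> (norm (f (x t)))\<^sup>2"
        unfolding a_def \<alpha>_def using \<open>c > 0\<close> by (intro power_mono) (auto simp: infdist_nonneg)
      also have "\<dots> = q t" by (simp add: f_def q_def norm_psd_sqrt_mult psd_R)
      finally show ?thesis .
    qed
    \<comment> \<open>Since \<open>0 \<le> a t \<le> q t\<close>, gauge integrability of
      \<open>q\<close> is enough to make the measurable \<open>a\<close> Lebesgue integrable, which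
      allows the integral of \<open>p t - a t\<close> to be split.\<close>
    have a: "set_integrable lebesgue {0..T} a"
      using meas
    proof (rule measurable_bounded_by_integrable_imp_absolutely_integrable)
      show "q integrable_on {0..T}" using q by blast
      show "norm (a t) \<le> q t" if "t \<in> {0..T}" for t
        using aq[OF that] by (simp add: a_def \<alpha>_def)
    qed auto
    have "(LINT t:{0..T}|lebesgue. a t) \<le> (LINT t:{0..T}|lebesgue. p t) - (H xT - H x0)"
      using has_integral_le[OF has_integral_set_lebesgue[OF a] q] aq by blast
    moreover have "(LINT t:{0..T}|lebesgue. p t - a t)
        = (LINT t:{0..T}|lebesgue. p t) - (LINT t:{0..T}|lebesgue. a t)"
      by (rule set_integral_diff[OF p a])
    ultimately show ?thesis
      using set_integral_diff(1)[OF p a] by (simp add: p_def a_def)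
  qed
  then show ?thesis
    unfolding dissipative_def using \<alpha> H_nonneg bounded by blast
qed

end
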